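(* Let $\mathbf u\in\{0,1\}^{\mathbb N}$ be an infinite word whose language is closed under all elements of $H=\{\mathrm{id},R,E,ER\}$. Then $\mathbf u$ is $H$-rich if and only if $S(\mathbf u)$ is $R$-rich. Likewise, $\mathbf u$ is almost $H$-rich if and only if $S(\mathbf u)$ is almost $R$-rich.
   Context: Alphabet $\{0,1\}$. For an infinite word $\mathbf u$, $\mathcal L(\mathbf u)$ denotes its set of finite factors (including the empty word $\varepsilon$). $R$ is the reversal antimorphism $R(w_0\cdots w_n)=w_n\cdots w_0$; $E$ is the antimorphism $E(w_0\cdots w_n)=\overline{w_n}\cdots\overline{w_0}$ where $\overline0=1,\overline1=0$; $ER=RE$ is the morphism exchanging the letters. $\mathbf u$ is closed under a map $\mu$ if $\mu(w)\in\mathcal L(\mathbf u)$ for every $w\in\mathcal L(\mathbf u)$. A word $p$ is an $R$-palindrome (resp. $E$-palindrome) if $R(p)=p$ (resp. $E(p)=p$). For a finite word $w$: $\mathrm{Pal}^R(w)$ is the set of $R$-palindromic factors of $w$ including $\varepsilon$, and $D^R(w)=|w|+1-\#\mathrm{Pal}^R(w)$; $\mathrm{Pal}^H(w)$ is the set of orbits $[p]=\{\mu(p):\mu\in H\}$ of factors $p$ of $w$ (including $\varepsilon$) that are $R$-palindromes or $E$-palindromes, and $D^H(w)=|w|+1-\#\mathrm{Pal}^H(w)$. For an infinite word, $D^X(\mathbf u)=\sup\{D^X(w):w\in\mathcal L(\mathbf u)\}$ ($X\in\{R,H\}$); $\mathbf u$ is $X$-rich if $D^X(\mathbf u)=0$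 and almost $X$-rich if $D^X(\mathbf u)<\infty$. The map $S$ is defined on infinite binary words by $S(u_0u_1u_2\cdots)=v_1v_2\cdots$ with $v_i=(u_{i-1}+u_i)\bmod 2$ for $i\ge1$. *)

theory Defs
  imports
    "HOL-Library.Z2"
    "HOL-Library.Sublist"
    "HOL-Library.Extended_Real"
begin

text \<open>
  Letters are the elements of the two-element field \<^typ>\<open>bit\<close>, so that addition of letters is
  addition modulo 2. Finite words are lists, infinite words are functions on \<^typ>\<open>nat\<close>.
\<close>

type_synonym word = "bit list"
type_synonym infword = "nat \<Rightarrow> bit"

definition letter_compl :: "bit \<Rightarrow> bit" where
  "letter_compl a = (if a = 0 then 1 else 0)"

text \<open>The antimorphisms \<open>R\<close> and \<open>E\<close>, and the group \<open>H\<close> they generate.\<close>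

definition R_map :: "word \<Rightarrow> word" where
  "R_map w = rev w"

definition E_map :: "word \<Rightarrow> word" where
  "E_map w = map letter_compl (rev w)"

definition H_group :: "(word \<Rightarrow> word) set" where
  "H_group = {id, R_map, E_map, E_map \<circ> R_map}"

definition language :: "infword \<Rightarrow> word set" where
  "language u = {map u [i..<i + n] | i n. True}"

definition closed_under :: "infword \<Rightarrow> (word \<Rightarrow> word) \<Rightarrow> bool" where
  "closed_under u \<mu> \<longleftrightarrow> (\<forall>w \<in> language u. \<mu> w \<in> language u)"

definition R_palindrome :: "word \<Rightarrow> bool" where
  "R_palindrome p \<longleftrightarrow> R_map p = p"

definition E_palindrome :: "word \<Rightarrow> bool" where
  "E_palindrome p \<longleftrightarrow> E_map p = p"

text \<open>
  The library's \<^const>\<open>sublist\<close> means contiguous sublist, i.e. factor (possibly empty).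
\<close>

definition Pal_R :: "word \<Rightarrow> word set" where
  "Pal_R w = {p. sublist p w \<and> R_palindrome p}"

definition H_orbit :: "word \<Rightarrow> word set" where
  "H_orbit p = {\<mu> p | \<mu>. \<mu> \<in> H_group}"

definition Pal_H :: "word \<Rightarrow> word set set" where
  "Pal_H w = {H_orbit p | p. sublist p w \<and> (R_palindrome p \<or> E_palindrome p)}"

text \<open>
  Defects of finite words are integer-valued, to avoid truncated subtraction; defects of infinite
  words are extended reals, so that the supremum is \<open>\<infinity>\<close> exactly when it is unbounded.
\<close>

definition defect_R :: "word \<Rightarrow> int" where
  "defect_R w = int (length w) + 1 - int (card (Pal_R w))"

definition defect_H :: "word \<Rightarrow> int" where
  "defect_H w = int (length w) + 1 - int (card (Pal_H w))"

definition inf_defect_R :: "infword \<Rightarrow> ereal" where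
  "inf_defect_R u = (SUP w \<in> language u. ereal (real_of_int (defect_R w)))"

definition inf_defect_H :: "infword \<Rightarrow> ereal" where
  "inf_defect_H u = (SUP w \<in> language u. ereal (real_of_int (defect_H w)))"

definition R_rich :: "infword \<Rightarrow> bool" where
  "R_rich u \<longleftrightarrow> inf_defect_R u = 0"

definition H_rich :: "infword \<Rightarrow> bool" where
  "H_rich u \<longleftrightarrow> inf_defect_H u = 0"

definition almost_R_rich :: "infword \<Rightarrow> bool" where
  "almost_R_rich u \<longleftrightarrow> inf_defect_R u < \<infinity>"

definition almost_H_rich :: "infword \<Rightarrow> bool" where
  "almost_H_rich u \<longleftrightarrow> inf_defect_H u < \<infinity>"

text \<open>
  The map \<open>S\<close>: the letter with index \<open>n\<close> below is the letter \<open>v\<close> with index \<open>i = n + 1\<close> of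
  \<open>S(u) = v\<^sub>1v\<^sub>2\<dots>\<close>, where \<open>v\<^sub>i = (u\<^sub>i\<^sub>-\<^sub>1 + u\<^sub>i) mod 2\<close>.
\<close>

definition S_map :: "infword \<Rightarrow> infword" where
  "S_map u = (\<lambda>n. u n + u (Suc n))"

end

theory Submission
  imports Defs
begin

text \<open>
  The finite version of \<open>S\<close> identifies exactly a word and its complement, commutes with reversal,
  and maps the nonempty factors of \<open>w\<close> onto the factors of \<open>S w\<close>. Hence the orbits of nonempty
  \<open>R\<close>- or \<open>E\<close>-palindromic factors of \<open>w\<close> correspond bijectively to the \<open>R\<close>-palindromic factors of
  \<open>S w\<close>. As \<open>S w\<close> is one letter shorter and the orbit of the empty word is left over, the
  \<open>H\<close>-defect of \<open>w\<close> equals the \<open>R\<close>-defect of \<open>S w\<close>, and the two suprema coincide.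
\<close>

declare add_bit_eq_xor [simp del]

text \<open>Both \<open>[]\<close> and every one-letter word are sent to \<open>[]\<close>, so the
  empty word has to be treated apart in the results below.\<close>

definition S_fin :: "word \<Rightarrow> word" where
  "S_fin w = map2 (+) w (tl w)"

definition compl_word :: "word \<Rightarrow> word" where
  "compl_word w = map letter_compl w"

lemma letter_compl_eq_plus_one: "letter_compl a = a + 1"
  by (cases a) (simp_all add: letter_compl_def)

lemma letter_compl_add: "letter_compl a + letter_compl b = a + b"
  by (cases a; cases b) (simp_all add: letter_compl_eq_plus_one)

lemma length_S_fin [simp]: "length (S_fin w) = length w - 1"
  by (simp add: S_fin_def)

lemma nth_S_fin: "i < length w - 1 \<Longrightarrow> S_fin w ! i = w ! i + w ! Suc i"
  by (simp add: S_fin_def nth_tl)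

lemma S_fin_Nil [simp]: "S_fin [] = []"
  by (simp add: S_fin_def)

lemma S_fin_Cons_Cons: "S_fin (a # b # w) = (a + b) # S_fin (b # w)"
  by (simp add: S_fin_def)

lemma length_compl_word [simp]: "length (compl_word w) = length w"
  by (simp add: compl_word_def)

lemma S_fin_compl_word [simp]: "S_fin (compl_word w) = S_fin w"
  by (rule nth_equalityI) (simp_all add: nth_S_fin compl_word_def letter_compl_add)

lemma compl_word_compl_word [simp]: "compl_word (compl_word w) = w"
  by (induction w) (auto simp: compl_word_def letter_compl_def)

lemma S_fin_rev: "S_fin (rev w) = rev (S_fin w)"
proof (rule nth_equalityI)
  fix i assume "i < length (S_fin (rev w))"
  then have i: "Suc i < length w" by simp
  then have "length w - Suc i = Suc (length w - Suc (Suc i))" by simp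
  with i show "S_fin (rev w) ! i = rev (S_fin w) ! i"
    by (simp add: nth_S_fin rev_nth add.commute)
qed simp

text \<open>Each letter is recovered from its predecessor and their sum, so the first letter and the
  sums determine the whole word.\<close>

lemma S_fin_eq_imp_eq:
  assumes "length v = length w" "S_fin v = S_fin w" "v \<noteq> []" "hd v = hd w"
  shows "v = w"
  using assms
proof (induction v w rule: list_induct2)
  case (Cons a v b w)
  show ?case
  proof (cases v)
    case Nil
    with Cons show ?thesis by simp
  next
    case v: (Cons c v')
    moreover obtain d w' where "w = d # w'"
      using v \<open>length v = length w\<close> by (cases w) simp_all
    ultimately show ?thesis
      using Cons.IH Cons.prems by (auto simp: S_fin_Cons_Cons)
  qed
qed simp

lemma S_fin_eq_iff:
  assumes "v \<noteq> []" "w \<noteq> []"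
  shows "S_fin v = S_fin w \<longleftrightarrow> v = w \<or> v = compl_word w"
proof
  assume eq: "S_fin v = S_fin w"
  then have "length v - 1 = length w - 1"
    by (metis length_S_fin)
  with assms have len: "length v = length w"
    by (cases v; cases w) simp_all
  show "v = w \<or> v = compl_word w"
  proof (cases "hd v = hd w")
    case True
    with S_fin_eq_imp_eq len eq assms show ?thesis by blast
  next
    case False
    \<comment> \<open>With only two letters, differing first letters are complementary. As
      \<open>compl_word w\<close> has the same sums as \<open>w\<close>, it can replace
      \<open>w\<close>.\<close>
    then have "hd v = hd (compl_word w)"
      using assms(2) by (cases "hd v"; cases "hd w") (auto simp: compl_word_def hd_map letter_compl_def)
    with S_fin_eq_imp_eq[of v "compl_word w"] len eq assms show ?thesis by simp
  qed
qed auto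

lemma R_or_E_palindrome_iff_S_fin:
  assumes "p \<noteq> []"
  shows "R_palindrome p \<or> E_palindrome p \<longleftrightarrow> R_palindrome (S_fin p)"
proof -
  \<comment> \<open>\<open>S_fin\<close> commutes with reversal, so the palindrome condition says
    that \<open>rev p\<close> and \<open>p\<close> have the same image.\<close>
  have "R_palindrome (S_fin p) \<longleftrightarrow> rev p = p \<or> rev p = compl_word p"
    using S_fin_eq_iff[of "rev p" p] assms by (simp add: R_palindrome_def R_map_def S_fin_rev)
  also have "\<dots> \<longleftrightarrow> R_palindrome p \<or> E_palindrome p"
    by (metis R_palindrome_def R_map_def E_palindrome_def E_map_def compl_word_def
        compl_word_compl_word)
  finally show ?thesis ..
qed

text \<open>For either kind of palindrome, reversal acts as the identity or as complementation. The
  orbit of a nonempty palindrome is thus exactly its class under equality of \<open>S_fin\<close>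
  values.\<close>

lemma H_orbit_palindrome:
  assumes "R_palindrome p \<or> E_palindrome p"
  shows "H_orbit p = {p, compl_word p}"
proof -
  have "H_orbit p = {p, rev p, compl_word (rev p), compl_word p}"
    by (auto simp: H_orbit_def H_group_def R_map_def E_map_def compl_word_def
        intro: exI[of _ id] exI[of _ R_map] exI[of _ E_map] exI[of _ "E_map \<circ> R_map"])
  moreover have "rev p = p \<or> rev p = compl_word p"
    using assms by (metis R_palindrome_def R_map_def E_palindrome_def E_map_def compl_word_def
        compl_word_compl_word)
  ultimately show ?thesis by auto
qed

lemma sublist_iff_take_drop: "sublist q w \<longleftrightarrow> (\<exists>i n. q = take n (drop i w))"
proof
  assume "sublist q w"
  then obtain a b where "w = a @ q @ b" by (auto simp: sublist_def)
  then have "q = take (length q) (drop (length a) w)" by simp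
  then show "\<exists>i n. q = take n (drop i w)" by blast
next
  assume "\<exists>i n. q = take n (drop i w)"
  then show "sublist q w"
    by (metis append_take_drop_id sublist_appendI)
qed

lemma S_fin_take_drop: "S_fin (take (Suc n) (drop i w)) = take n (drop i (S_fin w))"
  by (rule nth_equalityI) (auto simp: nth_S_fin)

lemma sublists_S_fin:
  assumes "w \<noteq> []"
  shows "{q. sublist q (S_fin w)} = S_fin ` {p. sublist p w \<and> p \<noteq> []}"
proof (intro equalityI subsetI)
  fix q assume "q \<in> {q. sublist q (S_fin w)}"
  then obtain i n where q: "q = take n (drop i (S_fin w))"
    by (auto simp: sublist_iff_take_drop)
  show "q \<in> S_fin ` {p. sublist p w \<and> p \<noteq> []}"
  proof (cases "i < length w")
    case True
    then have "take (Suc n) (drop i w) \<in> {p. sublist p w \<and> p \<noteq> []}"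
      by (auto simp: sublist_iff_take_drop)
    then show ?thesis
      unfolding q S_fin_take_drop[symmetric] by blast
  next
    case False
    \<comment> \<open>A start beyond the last letter gives the empty factor, whose nonempty preimage
      can be any single letter of \<open>w\<close>.\<close>
    then have "q = S_fin [hd w]"
      by (simp add: q S_fin_def)
    moreover have "sublist [hd w] w"
      using assms by (cases w) (auto intro: sublist_appendI[of "[_]" "[]", simplified])
    ultimately show ?thesis by blast
  qed
next
  fix q assume "q \<in> S_fin ` {p. sublist p w \<and> p \<noteq> []}"
  then obtain i n where q: "q = S_fin (take n (drop i w))" and "take n (drop i w) \<noteq> []"
    by (auto simp: sublist_iff_take_drop)
  then obtain m where "n = Suc m" by (cases n) auto
  with q show "q \<in> {q. sublist q (S_fin w)}"
    by (auto simp: S_fin_take_drop sublist_iff_take_drop)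
qed

lemma finite_sublists: "finite {p. sublist p w}"
  by (simp flip: set_sublists_eq)

lemma card_Pal_H:
  assumes "w \<noteq> []"
  shows "card (Pal_H w) = Suc (card (Pal_R (S_fin w)))"
proof -
  define P where "P = {p. sublist p w \<and> p \<noteq> [] \<and> (R_palindrome p \<or> E_palindrome p)}"
  have fin: "finite P"
    unfolding P_def by (rule finite_subset[OF _ finite_sublists[of w]]) auto
  have "R_palindrome []"
    by (simp add: R_palindrome_def R_map_def)
  then have Pal_H: "Pal_H w = insert (H_orbit []) (H_orbit ` P)"
    by (auto simp: Pal_H_def P_def)
  have Pal_R: "Pal_R (S_fin w) = S_fin ` P"
    using sublists_S_fin[OF assms] R_or_E_palindrome_iff_S_fin
    unfolding Pal_R_def P_def by (auto simp: set_eq_iff image_iff)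
  have orbit: "H_orbit p = {p, compl_word p}" if "p \<in> P" for p
    using that H_orbit_palindrome by (auto simp: P_def)
  have S_orbit: "S_fin ` H_orbit p = {S_fin p}" if "p \<in> P" for p
    by (simp add: orbit[OF that])
  \<comment> \<open>Taking images under \<open>S_fin\<close> turns each orbit into a singleton, so
    that counting orbits becomes counting the words \<open>S_fin p\<close>.\<close>
  have inj: "inj_on ((`) S_fin) (H_orbit ` P)"
  proof (rule inj_onI, clarify)
    fix p q assume pq: "p \<in> P" "q \<in> P" and "S_fin ` H_orbit p = S_fin ` H_orbit q"
    then have "S_fin p = S_fin q" by (simp add: S_orbit)
    then have "p = q \<or> p = compl_word q"
      using pq S_fin_eq_iff by (simp add: P_def)
    then show "H_orbit p = H_orbit q"
      using pq by (auto simp: orbit)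
  qed
  have "card (H_orbit ` P) = card ((`) S_fin ` H_orbit ` P)"
    by (simp add: card_image[OF inj])
  also have "(`) S_fin ` H_orbit ` P = (\<lambda>q. {q}) ` S_fin ` P"
    using S_orbit by (simp add: image_image)
  also have "card \<dots> = card (S_fin ` P)"
    by (rule card_image) (simp add: inj_on_def)
  finally have "card (H_orbit ` P) = card (Pal_R (S_fin w))"
    by (simp add: Pal_R)
  \<comment> \<open>This orbit supplies the extra \<open>Suc\<close>: the empty palindrome of
    \<open>S_fin w\<close> is already accounted for by the one-letter factors of
    \<open>w\<close>.\<close>
  moreover have "H_orbit [] \<notin> H_orbit ` P"
  proof
    assume "H_orbit [] \<in> H_orbit ` P"
    then obtain p where p: "p \<in> P" "H_orbit [] = {p, compl_word p}"
      using orbit by auto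
    have "[] \<in> H_orbit []"
      by (auto simp: H_orbit_def H_group_def intro!: exI[of _ id])
    then show False
      using p by (auto simp: P_def compl_word_def)
  qed
  ultimately show ?thesis
    using fin by (simp add: Pal_H)
qed

lemma defect_H_eq_defect_R_S_fin: "defect_H w = defect_R (S_fin w)"
proof (cases "w = []")
  case True
  \<comment> \<open>Here neither the length nor the number of palindromes drops by one, and both
    defects are 0.\<close>
  have "Pal_H [] = {H_orbit []}" "Pal_R [] = {[]}"
    by (auto simp: Pal_H_def Pal_R_def R_palindrome_def R_map_def)
  with True show ?thesis
    by (simp add: defect_H_def defect_R_def)
next
  case False
  then have "length w = Suc (length (S_fin w))" by (cases w) simp_all
  then show ?thesis
    using card_Pal_H[OF False] by (simp only: defect_H_def defect_R_def)
qed

lemma S_fin_factor: "S_fin (map u [i..<i + Suc n]) = map (S_map u) [i..<i + n]"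
  by (rule nth_equalityI) (simp_all add: nth_S_fin S_map_def del: upt_Suc)

lemma language_S_map: "language (S_map u) = S_fin ` language u"
proof (intro equalityI subsetI)
  fix q assume "q \<in> language (S_map u)"
  then obtain i n where "q = S_fin (map u [i..<i + Suc n])"
    by (auto simp: language_def S_fin_factor simp del: upt_Suc add_Suc_right)
  then show "q \<in> S_fin ` language u"
    unfolding language_def by blast
next
  fix q assume "q \<in> S_fin ` language u"
  then obtain i n where q: "q = S_fin (map u [i..<i + n])"
    by (auto simp: language_def)
  show "q \<in> language (S_map u)"
  proof (cases n)
    \<comment> \<open>A window of length 0 has no shorter window to correspond to; it goes to the
      empty factor of \<open>S_map u\<close>.\<close>
    case 0
    then have "q = map (S_map u) [i..<i + 0]" by (simp add: q)
    then show ?thesis unfolding language_def by blast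
  next
    case (Suc m)
    then have "q = map (S_map u) [i..<i + m]"
      unfolding q by (simp only: S_fin_factor)
    then show ?thesis unfolding language_def by blast
  qed
qed

text \<open>Rewriting the language of \<open>S_map u\<close> as an image under \<open>S_fin\<close>
  makes both suprema range over \<open>language u\<close>, where they agree term by term.\<close>

lemma inf_defect_H_eq_inf_defect_R_S_map: "inf_defect_H u = inf_defect_R (S_map u)"
  by (simp add: inf_defect_H_def inf_defect_R_def language_S_map image_image
      defect_H_eq_defect_R_S_fin)

theorem mainTheorem1:
  fixes u :: infword
  assumes "\<forall>\<mu> \<in> H_group. closed_under u \<mu>"
  shows "(H_rich u \<longleftrightarrow> R_rich (S_map u)) \<and> (almost_H_rich u \<longleftrightarrow> almost_R_rich (S_map u))"
  by (simp add: H_rich_def R_rich_def almost_H_rich_def almost_R_rich_def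
      inf_defect_H_eq_inf_defect_R_S_map)

end
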